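(* The maximum gap for the marriage model satisfies $$\max_{I\in\mathcal I_{\rm Marriage}}\frac{\mathrm{OPT}(I)}{\mathrm{WST}(I)}=2,$$ where $\mathcal I_{\rm Marriage}$ is the family of instances of HRT-MSLQ in which every hospital has upper quota $1$. Moreover, this equality holds even if the maximum is restricted to such instances in which ties appear only in preference lists of residents.
   Context: An instance $I$ of HRT-MSLQ consists of a set $R=\{r_1,\dots,r_n\}$ of residents ($n\ge 1$) and a set $H=\{h_1,\dots,h_m\}$ of hospitals. Each resident $r$ has a complete preference list over $H$ that may contain ties (a total preorder $\succeq_r$; $\succ_r$ is strict preference), and each hospital likewise has a complete preference list over $R$ that may contain ties. Each hospital $h$ has an integer lower quota $\ell(h)$ and upper quota $u(h)$ with $0\le \ell(h)\le u(h)\le n$, $u(h)\ge 1$ (so in the marriage model $[\ell(h),u(h)]\in\{[0,1],[1,1]\}$). Standing assumption: $|R|<\sum_{h\in H}u(h)$. An assignment is a set $M\subseteq R\times H$; $M(r)=\{h:(r,h)\in M\}$, $M(h)=\{r:(r,h)\in M\}$. $M$ is a matching if $|M(r)|\le 1$ for all $r$ and $|M(h)|\le u(h)$ for all $h$; then $M(r)$ also denotes the unique hospital of a matched resident $r$. A pair $(r,h)$ blocks a matching $M$ if (i) $r$ is unmatched in $M$ or $h\succ_r M(r)$, and (ii) $|M(h)|<u(h)$ or $h$ strictly prefers $r$ to at least one resident in $M(h)$. $M$ is stable if no pair blocks it. The score of $h$ in $M$ is $s_M(h)=\min\{1,|M(h)|/\ell(h)\}$, with $s_M(h)=1$ if $\ell(h)=0$;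 the score of $M$ is $s(M)=\sum_{h\in H}s_M(h)$. $\mathrm{OPT}(I)$ and $\mathrm{WST}(I)$ are respectively the maximum and minimum of $s(M)$ over all stable matchings $M$ of $I$. *)

theory Defs
  imports Complex_Main
begin

text \<open>Residents and hospitals are identified with their indices \<open>1, \<dots>, n\<close> and \<open>1, \<dots>, m\<close>.
  A preference list is a relation in which \<open>(x, y)\<close> means that \<open>x\<close> is weakly preferred
  to \<open>y\<close>; a tie is a pair of distinct elements related in both directions.\<close>

record hrt_mslq =
  num_res :: nat
  num_hosp :: nat
  res_pref :: "nat \<Rightarrow> nat rel"
  hosp_pref :: "nat \<Rightarrow> nat rel"
  lower :: "nat \<Rightarrow> nat"
  upper :: "nat \<Rightarrow> nat"

definition residents :: "hrt_mslq \<Rightarrow> nat set" where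
  "residents I = {1..num_res I}"

definition hospitals :: "hrt_mslq \<Rightarrow> nat set" where
  "hospitals I = {1..num_hosp I}"

definition total_preorder_on :: "'a set \<Rightarrow> 'a rel \<Rightarrow> bool" where
  "total_preorder_on A p \<longleftrightarrow> preorder_on A p \<and> total_on A p"

definition strictly_prefers :: "'a rel \<Rightarrow> 'a \<Rightarrow> 'a \<Rightarrow> bool" where
  "strictly_prefers p x y \<longleftrightarrow> (x, y) \<in> p \<and> (y, x) \<notin> p"

text \<open>The last conjunct is the standing assumption that the total upper quota exceeds the
  number of residents.\<close>

definition hrt_mslq_instance :: "hrt_mslq \<Rightarrow> bool" where
  "hrt_mslq_instance I \<longleftrightarrow>
     num_res I \<ge> 1 \<and>
     (\<forall>r\<in>residents I. total_preorder_on (hospitals I) (res_pref I r)) \<and>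
     (\<forall>h\<in>hospitals I. total_preorder_on (residents I) (hosp_pref I h)) \<and>
     (\<forall>h\<in>hospitals I. lower I h \<le> upper I h \<and> upper I h \<le> num_res I \<and> upper I h \<ge> 1) \<and>
     num_res I < (\<Sum>h\<in>hospitals I. upper I h)"

definition marriage_instance :: "hrt_mslq \<Rightarrow> bool" where
  "marriage_instance I \<longleftrightarrow> hrt_mslq_instance I \<and> (\<forall>h\<in>hospitals I. upper I h = 1)"

definition ties_only_in_residents :: "hrt_mslq \<Rightarrow> bool" where
  "ties_only_in_residents I \<longleftrightarrow> (\<forall>h\<in>hospitals I. antisym (hosp_pref I h))"

definition hospitals_of :: "(nat \<times> nat) set \<Rightarrow> nat \<Rightarrow> nat set" where
  "hospitals_of M r = {h. (r, h) \<in> M}"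

definition residents_of :: "(nat \<times> nat) set \<Rightarrow> nat \<Rightarrow> nat set" where
  "residents_of M h = {r. (r, h) \<in> M}"

definition is_matching :: "hrt_mslq \<Rightarrow> (nat \<times> nat) set \<Rightarrow> bool" where
  "is_matching I M \<longleftrightarrow>
     M \<subseteq> residents I \<times> hospitals I \<and>
     (\<forall>r\<in>residents I. card (hospitals_of M r) \<le> 1) \<and>
     (\<forall>h\<in>hospitals I. card (residents_of M h) \<le> upper I h)"

definition blocks :: "hrt_mslq \<Rightarrow> (nat \<times> nat) set \<Rightarrow> nat \<Rightarrow> nat \<Rightarrow> bool" where
  "blocks I M r h \<longleftrightarrow>
     r \<in> residents I \<and> h \<in> hospitals I \<and>
     (hospitals_of M r = {} \<or> (\<exists>h'\<in>hospitals_of M r. strictly_prefers (res_pref I r) h h')) \<and>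
     (card (residents_of M h) < upper I h \<or>
      (\<exists>r'\<in>residents_of M h. strictly_prefers (hosp_pref I h) r r'))"

definition is_stable :: "hrt_mslq \<Rightarrow> (nat \<times> nat) set \<Rightarrow> bool" where
  "is_stable I M \<longleftrightarrow> is_matching I M \<and> \<not> (\<exists>r h. blocks I M r h)"

definition hosp_score :: "hrt_mslq \<Rightarrow> (nat \<times> nat) set \<Rightarrow> nat \<Rightarrow> real" where
  "hosp_score I M h =
     (if lower I h = 0 then 1 else min 1 (real (card (residents_of M h)) / real (lower I h)))"

definition score :: "hrt_mslq \<Rightarrow> (nat \<times> nat) set \<Rightarrow> real" where
  "score I M = (\<Sum>h\<in>hospitals I. hosp_score I M h)"

text \<open>An instance has finitely many matchings, so the sets below are finite.\<close>

definition OPT :: "hrt_mslq \<Rightarrow> real" where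
  "OPT I = Max {score I M |M. is_stable I M}"

definition WST :: "hrt_mslq \<Rightarrow> real" where
  "WST I = Min {score I M |M. is_stable I M}"

text \<open>\<^const>\<open>Max\<close> is meaningful only for finite sets; this also covers infinite ones.\<close>

definition is_maximum :: "'a::linorder set \<Rightarrow> 'a \<Rightarrow> bool" where
  "is_maximum S x \<longleftrightarrow> x \<in> S \<and> (\<forall>y\<in>S. y \<le> x)"

end

theory Submission
  imports Defs
begin

text \<open>In the marriage model the standing assumption says that there are more hospitals than
  residents, so some hospital is always empty and a stable matching matches all \<open>n\<close> residents.
  If \<open>k\<close> hospitals have lower quota \<open>0\<close>, the score of a stable matching is the size of the union
  of these \<open>k\<close> hospitals with the \<open>n\<close> matched ones, which lies between \<open>max k n\<close>
  and \<open>k + n \<le> 2 * max k n\<close>. For the gap \<open>2\<close>, take one resident who is indifferent between two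
  hospitals with lower quotas \<open>0\<close> and \<open>1\<close>.

  The bound also needs some stable matching to exist. Following Sotomayor, take, among the
  matchings whose blocking pairs all involve an unmatched resident, one that is best for the
  hospitals; satisfying a blocking pair with the best hospital for its resident would improve it.\<close>

section \<open>Matchings and blocking pairs when all upper quotas are 1\<close>

lemma finite_residents [simp]: "finite (residents I)"
  by (simp add: residents_def)

lemma finite_hospitals [simp]: "finite (hospitals I)"
  by (simp add: hospitals_def)

lemma is_matching_finite: "is_matching I M \<Longrightarrow> finite M"
  unfolding is_matching_def by (meson finite_SigmaI finite_hospitals finite_residents finite_subset)

lemma finite_matchings: "finite {M. is_matching I M}"
  by (rule finite_subset[of _ "Pow (residents I \<times> hospitals I)"]) (auto simp: is_matching_def)

lemma is_matching_marriage_iff: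
  assumes "marriage_instance I"
  shows "is_matching I M \<longleftrightarrow>
    M \<subseteq> residents I \<times> hospitals I \<and>
    (\<forall>r h h'. (r, h) \<in> M \<longrightarrow> (r, h') \<in> M \<longrightarrow> h = h') \<and>
    (\<forall>r r' h. (r, h) \<in> M \<longrightarrow> (r', h) \<in> M \<longrightarrow> r = r')"
\<comment> \<open>An infinite set has \<open>card\<close> 0, so \<open>card \<le> 1\<close> means
  "at most one element" only once finiteness is known; the inclusion supplies it.\<close>
proof (cases "M \<subseteq> residents I \<times> hospitals I")
  case True
  then have fin: "finite (hospitals_of M r)" "finite (residents_of M h)" for r h
    by (auto simp: hospitals_of_def residents_of_def
        intro: finite_subset[of _ "hospitals I"] finite_subset[of _ "residents I"])
  from True assms show ?thesis
    unfolding is_matching_def marriage_instance_def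
    by (simp add: card_le_Suc0_iff_eq[OF fin(1)] card_le_Suc0_iff_eq[OF fin(2)])
      (fastforce simp: hospitals_of_def residents_of_def)
qed (simp add: is_matching_def)

text \<open>Each side has at most one partner, so "no partner, or some partner is worse" becomes
  "every partner is worse".\<close>

lemma blocks_marriage_iff:
  assumes "marriage_instance I" "is_matching I M"
  shows "blocks I M r h \<longleftrightarrow>
    r \<in> residents I \<and> h \<in> hospitals I \<and>
    (\<forall>h'. (r, h') \<in> M \<longrightarrow> strictly_prefers (res_pref I r) h h') \<and>
    (\<forall>r'. (r', h) \<in> M \<longrightarrow> strictly_prefers (hosp_pref I h) r r')"
proof -
  note m = assms(2)[unfolded is_matching_marriage_iff[OF assms(1)]]
  have "finite (residents_of M h)"
    using m by (auto simp: residents_of_def intro: finite_subset[of _ "residents I"])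
  moreover have "upper I h = 1" if "h \<in> hospitals I"
    using that assms(1) by (simp add: marriage_instance_def)
  ultimately have "card (residents_of M h) < upper I h \<longleftrightarrow> residents_of M h = {}"
    if "h \<in> hospitals I"
    using that by simp
  moreover have "hospitals_of M r = {} \<or>
      (\<exists>h'\<in>hospitals_of M r. strictly_prefers (res_pref I r) h h') \<longleftrightarrow>
    (\<forall>h'. (r, h') \<in> M \<longrightarrow> strictly_prefers (res_pref I r) h h')"
    using m by (auto simp: hospitals_of_def)
  moreover have "residents_of M h = {} \<or>
      (\<exists>r'\<in>residents_of M h. strictly_prefers (hosp_pref I h) r r') \<longleftrightarrow>
    (\<forall>r'. (r', h) \<in> M \<longrightarrow> strictly_prefers (hosp_pref I h) r r')"
    using m by (auto simp: residents_of_def) metis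
  ultimately show ?thesis
    unfolding blocks_def by auto
qed

section \<open>Existence of a stable matching\<close>

lemma best_hospital:
  assumes "marriage_instance I" "r \<in> residents I" "A \<subseteq> hospitals I" "A \<noteq> {}"
  obtains h where "h \<in> A" "\<And>h'. h' \<in> A \<Longrightarrow> \<not> strictly_prefers (res_pref I r) h' h"
proof -
  have "trans (res_pref I r)"
    using assms(1,2)
    by (simp add: marriage_instance_def hrt_mslq_instance_def total_preorder_on_def preorder_on_def)
  then have "transp_on A (\<lambda>x y. strictly_prefers (res_pref I r) y x)"
    unfolding transp_on_def strictly_prefers_def by (blast dest: transD)
  moreover have "asymp_on A (\<lambda>x y. strictly_prefers (res_pref I r) y x)"
    by (auto simp: asymp_on_def strictly_prefers_def)
  moreover have "finite A"
    using assms(3) finite_subset finite_hospitals by blast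
  ultimately obtain h where "h \<in> A" "\<forall>x\<in>A. x \<noteq> h \<longrightarrow> \<not> strictly_prefers (res_pref I r) x h"
    using Finite_Set.bex_max_element[of A "\<lambda>x y. strictly_prefers (res_pref I r) y x"] assms(4)
    by auto
  then show ?thesis
    using that by (metis strictly_prefers_def)
qed

definition simple_matching :: "hrt_mslq \<Rightarrow> (nat \<times> nat) set \<Rightarrow> bool" where
  "simple_matching I M \<longleftrightarrow>
     is_matching I M \<and> (\<forall>r h. blocks I M r h \<longrightarrow> hospitals_of M r = {})"

text \<open>A rank potential: each pair counts the residents that \<open>h\<close> ranks weakly
  below \<open>r\<close>. It grows when a hospital trades up and, as \<open>r\<close> counts itself,
  also when an empty hospital is filled.\<close>

definition hosp_welfare :: "hrt_mslq \<Rightarrow> (nat \<times> nat) set \<Rightarrow> nat" where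
  "hosp_welfare I M = (\<Sum>(r, h)\<in>M. card {x \<in> residents I. (r, x) \<in> hosp_pref I h})"

text \<open>Assign the unmatched \<open>r\<close> to a best hospital \<open>h\<close> among those it
  blocks with. No hospital gets a worse occupant except one that becomes empty, and only
  \<open>h\<close> changes occupant, so a matched resident other than \<open>r\<close> that blocks
  now blocked before; \<open>r\<close> itself is content by the choice of \<open>h\<close>.\<close>

lemma simple_matching_improve:
  assumes I: "marriage_instance I" and M: "simple_matching I M" and b: "blocks I M r h0"
  obtains M' where "simple_matching I M'" "hosp_welfare I M < hosp_welfare I M'"
proof -
  from M have mM: "is_matching I M" and sM: "\<And>r h. blocks I M r h \<Longrightarrow> hospitals_of M r = {}"
    by (auto simp: simple_matching_def)
  note m = mM[unfolded is_matching_marriage_iff[OF I]]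
  note bM = blocks_marriage_iff[OF I mM]
  have r: "r \<in> residents I" and r_free: "(r, h') \<notin> M" for h'
    using b sM[OF b] by (simp_all add: blocks_def hospitals_of_def)
  obtain h where h: "blocks I M r h"
    and best: "\<And>h'. blocks I M r h' \<Longrightarrow> \<not> strictly_prefers (res_pref I r) h' h"
    by (rule best_hospital[OF I r, of "{h. blocks I M r h}"]) (use b in \<open>auto simp: blocks_def\<close>)
  have hH: "h \<in> hospitals I" and
    h_gain: "\<And>r'. (r', h) \<in> M \<Longrightarrow> strictly_prefers (hosp_pref I h) r r'"
    using h[unfolded bM] by blast+
  have pre: "refl_on (residents I) (hosp_pref I h)" "trans (hosp_pref I h)"
    using I hH
    by (auto simp: marriage_instance_def hrt_mslq_instance_def total_preorder_on_def preorder_on_def)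
  \<comment> \<open>\<open>K\<close> dismisses the occupant of \<open>h\<close>, if there is
    one.\<close>
  define K where "K = {p \<in> M. snd p \<noteq> h}"
  define M' where "M' = insert (r, h) K"
  have K_iff: "(x, y) \<in> K \<longleftrightarrow> (x, y) \<in> M \<and> y \<noteq> h" for x y
    by (auto simp: K_def)
  have mM': "is_matching I M'"
    unfolding is_matching_marriage_iff[OF I] M'_def using m r hH r_free
    by (auto simp: K_iff)
  note bM' = blocks_marriage_iff[OF I mM']
  have "hospitals_of M' x = {}" if bl: "blocks I M' x y" for x y
  proof (rule ccontr)
    assume "hospitals_of M' x \<noteq> {}"
    then obtain z where z: "(x, z) \<in> M'"
      by (auto simp: hospitals_of_def)
    from bl[unfolded bM'] have x: "x \<in> residents I" and y: "y \<in> hospitals I"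
      and xy: "\<And>h'. (x, h') \<in> M' \<Longrightarrow> strictly_prefers (res_pref I x) y h'"
      and yx: "\<And>r'. (r', y) \<in> M' \<Longrightarrow> strictly_prefers (hosp_pref I y) x r'"
      by blast+
    show False
    proof (cases "x = r")
      case True
      then have yh: "strictly_prefers (res_pref I r) y h"
        using xy by (simp add: M'_def)
      then have "y \<noteq> h"
        by (auto simp: strictly_prefers_def)
      \<comment> \<open>Away from \<open>h\<close> the occupants are those of \<open>M\<close>, and
        \<open>r\<close> is unmatched in \<open>M\<close>.\<close>
      then have "blocks I M r y"
        using True x y yx r_free by (auto simp: bM M'_def K_iff)
      with best yh show False
        by blast
    next
      case False
      then have zM: "(x, z) \<in> M"
        using z by (auto simp: M'_def K_iff)
      \<comment> \<open>At \<open>h\<close>, \<open>x\<close> beats \<open>r\<close>, who beats the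
        former occupant; any other hospital keeps its occupant.\<close>
      have "strictly_prefers (hosp_pref I y) x r'" if "(r', y) \<in> M" for r'
      proof (cases "y = h")
        case True
        then have "strictly_prefers (hosp_pref I h) x r"
          using yx by (simp add: M'_def)
        moreover have "strictly_prefers (hosp_pref I h) r r'"
          using h_gain that True by simp
        ultimately show ?thesis
          using pre(2) True unfolding strictly_prefers_def by (blast dest: transD)
      next
        case False
        then show ?thesis
          using yx that by (simp add: M'_def K_iff)
      qed
      moreover have "strictly_prefers (res_pref I x) y h'" if "(x, h') \<in> M" for h'
        using that zM m xy z by metis
      ultimately have "blocks I M x y"
        using x y by (simp add: bM)
      with sM zM show False
        by (auto simp: hospitals_of_def)
    qed
  qed
  then have "simple_matching I M'"
    using mM' by (simp add: simple_matching_def)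
  moreover have "hosp_welfare I M < hosp_welfare I M'"
  proof -
    let ?w = "\<lambda>(r, h). card {x \<in> residents I. (r, x) \<in> hosp_pref I h}"
    have finK: "finite K"
      using is_matching_finite[OF mM] by (simp add: K_def)
    have M'_w: "hosp_welfare I M' = ?w (r, h) + sum ?w K"
      unfolding hosp_welfare_def M'_def using finK by (subst sum.insert) (auto simp: K_iff)
    have "r \<in> {x \<in> residents I. (r, x) \<in> hosp_pref I h}"
      using pre(1) r by (auto simp: refl_on_def)
    then have pos: "0 < ?w (r, h)"
      by (auto simp: card_gt_0_iff)
    show ?thesis
    proof (cases "\<exists>q. (q, h) \<in> M")
      case True
      then obtain q where q: "(q, h) \<in> M" ..
      then have "M = insert (q, h) K"
        using m by (auto simp: K_def)
      moreover have "(q, h) \<notin> K"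
        by (simp add: K_def)
      ultimately have M_w: "hosp_welfare I M = ?w (q, h) + sum ?w K"
        unfolding hosp_welfare_def using finK by simp
      have "strictly_prefers (hosp_pref I h) r q" "q \<in> residents I"
        using h_gain q m by auto
      \<comment> \<open>Transitivity gives the inclusion; \<open>r\<close> lies only in the larger
        set, which makes it strict.\<close>
      then have "{x \<in> residents I. (q, x) \<in> hosp_pref I h}
          \<subset> {x \<in> residents I. (r, x) \<in> hosp_pref I h}"
        using pre r unfolding strictly_prefers_def refl_on_def by (blast dest: transD)
      then have "?w (q, h) < ?w (r, h)"
        by (simp add: psubset_card_mono)
      with M_w M'_w show ?thesis
        by simp
    next
      case False
      then have "M = K"
        by (auto simp: K_def)
      then show ?thesis
        using M'_w pos by (simp add: hosp_welfare_def)
    qed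
  qed
  ultimately show ?thesis
    using that by blast
qed

lemma stable_matching_exists:
  assumes I: "marriage_instance I"
  obtains M where "is_stable I M"
proof -
  let ?S = "{M. simple_matching I M}"
  have "finite ?S"
    by (rule finite_subset[OF _ finite_matchings[of I]]) (auto simp: simple_matching_def)
  \<comment> \<open>In the empty matching every resident is unmatched, so its blocking pairs are all
    permitted.\<close>
  moreover have "{} \<in> ?S"
    by (simp add: simple_matching_def is_matching_marriage_iff[OF I] hospitals_of_def)
  ultimately obtain M where M: "simple_matching I M"
    and "hosp_welfare I M = (MAX M\<in>?S. hosp_welfare I M)"
    by (metis (lifting) empty_iff mem_Collect_eq obtains_MAX)
  then have "hosp_welfare I M' \<le> hosp_welfare I M" if "simple_matching I M'" for M'
    using that \<open>finite ?S\<close> by simp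
  then have "\<not> blocks I M r h" for r h
    using simple_matching_improve[OF I M] by (metis not_less)
  then show ?thesis
    using that M by (auto simp: is_stable_def simple_matching_def)
qed

section \<open>Scores of stable matchings and the upper bound\<close>

text \<open>Counting leaves an empty hospital, which would block with any unmatched
  resident.\<close>

lemma stable_card_hospitals:
  assumes I: "marriage_instance I" and M: "is_stable I M"
  shows "card (snd ` M) = num_res I"
proof -
  have mM: "is_matching I M" and nb: "\<And>r h. \<not> blocks I M r h"
    using M by (auto simp: is_stable_def)
  note m = mM[unfolded is_matching_marriage_iff[OF I]]
  have inj: "inj_on fst M" "inj_on snd M"
    using m by (auto simp: inj_on_def)
  have fst: "fst ` M \<subseteq> residents I" and snd: "snd ` M \<subseteq> hospitals I"
    using m by auto
  have "num_res I < (\<Sum>h\<in>hospitals I. upper I h)"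
    using I unfolding marriage_instance_def hrt_mslq_instance_def by blast
  also have "\<dots> = (\<Sum>h\<in>hospitals I. 1)"
    using I by (intro sum.cong) (auto simp: marriage_instance_def)
  also have "\<dots> = card (hospitals I)"
    by simp
  finally have more: "card (residents I) < card (hospitals I)"
    by (simp add: residents_def)
  have "card (snd ` M) = card (fst ` M)"
    using inj by (simp add: card_image)
  also have "\<dots> \<le> card (residents I)"
    using fst by (simp add: card_mono)
  finally have "snd ` M \<noteq> hospitals I"
    using more by (metis not_less)
  then obtain h where h: "h \<in> hospitals I" "h \<notin> snd ` M"
    using snd by blast
  have "r \<in> fst ` M" if "r \<in> residents I" for r
  proof (rule ccontr)
    assume "r \<notin> fst ` M"
    then have "(r, h') \<notin> M" for h'
      by (metis fst_conv image_eqI)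
    moreover have "(r', h) \<notin> M" for r'
      using h(2) by (metis snd_conv image_eqI)
    ultimately have "blocks I M r h"
      using h(1) that by (simp add: blocks_marriage_iff[OF I mM])
    with nb show False
      by blast
  qed
  with fst have "fst ` M = residents I"
    by blast
  with \<open>card (snd ` M) = card (fst ` M)\<close> show ?thesis
    by (simp add: residents_def)
qed

text \<open>Lower quotas are 0 or 1, so a hospital scores 1 if its lower quota is 0 or it is
  matched, and 0 otherwise.\<close>

lemma score_marriage:
  assumes I: "marriage_instance I" and M: "is_matching I M"
  shows "score I M = card ({h \<in> hospitals I. lower I h = 0} \<union> snd ` M)"
proof -
  note m = M[unfolded is_matching_marriage_iff[OF I]]
  have "hosp_score I M h = (if h \<in> {h \<in> hospitals I. lower I h = 0} \<union> snd ` M then 1 else 0)"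
    if h: "h \<in> hospitals I" for h
  proof -
    have "lower I h = 0 \<or> lower I h = 1"
      using I h by (auto simp: marriage_instance_def hrt_mslq_instance_def)
    moreover have "residents_of M h = {}" if "h \<notin> snd ` M"
      using that by (force simp: residents_of_def)
    moreover have "card (residents_of M h) = 1" if hM: "h \<in> snd ` M"
    proof -
      from hM obtain r where "(r, h) \<in> M"
        by auto
      then have "residents_of M h = {r}"
        using m by (auto simp: residents_of_def)
      then show ?thesis
        by simp
    qed
    ultimately show ?thesis
      using h by (auto simp: hosp_score_def)
  qed
  then have "score I M =
      (\<Sum>h\<in>hospitals I. if h \<in> {h \<in> hospitals I. lower I h = 0} \<union> snd ` M then 1 else 0)"
    by (simp add: score_def)
  also have "\<dots> = card (hospitals I \<inter> ({h \<in> hospitals I. lower I h = 0} \<union> snd ` M))"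
    by (subst sum.inter_restrict[symmetric]) auto
  also have "hospitals I \<inter> ({h \<in> hospitals I. lower I h = 0} \<union> snd ` M) =
      {h \<in> hospitals I. lower I h = 0} \<union> snd ` M"
    using m by auto
  finally show ?thesis .
qed

lemma finite_stable_scores: "finite {score I M |M. is_stable I M}"
proof -
  have "{score I M |M. is_stable I M} \<subseteq> score I ` {M. is_matching I M}"
    by (auto simp: is_stable_def)
  then show ?thesis
    using finite_matchings finite_surj by blast
qed

lemma marriage_gap_le:
  assumes I: "marriage_instance I"
  shows "OPT I / WST I \<le> 2"
proof -
  let ?S = "{score I M |M. is_stable I M}"
  have "?S \<noteq> {}"
    using stable_matching_exists[OF I] by blast
  then have "OPT I \<in> ?S" "WST I \<in> ?S"
    unfolding OPT_def WST_def
    using Max_in[OF finite_stable_scores] Min_in[OF finite_stable_scores] by simp_all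
  then obtain M N where M: "is_stable I M" "WST I = score I M"
    and N: "is_stable I N" "OPT I = score I N"
    by blast
  let ?Z = "{h \<in> hospitals I. lower I h = 0}"
  have "card (?Z \<union> snd ` N) \<le> card ?Z + num_res I"
    using card_Un_le[of ?Z "snd ` N"] stable_card_hospitals[OF I N(1)] by simp
  moreover have "finite (?Z \<union> snd ` M)"
    using M is_matching_finite by (auto simp: is_stable_def)
  then have "card ?Z \<le> card (?Z \<union> snd ` M)" "num_res I \<le> card (?Z \<union> snd ` M)"
    unfolding stable_card_hospitals[OF I M(1), symmetric] by (auto intro!: card_mono)
  ultimately have "card (?Z \<union> snd ` N) \<le> 2 * card (?Z \<union> snd ` M)"
    by linarith
  then have le: "OPT I \<le> 2 * WST I"
    using M N score_marriage[OF I] by (simp add: is_stable_def)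
  \<comment> \<open>A resident exists and is matched, so \<open>WST I\<close> is positive and may be
    divided by.\<close>
  have "1 \<le> num_res I"
    using I by (simp add: marriage_instance_def hrt_mslq_instance_def)
  with \<open>num_res I \<le> card (?Z \<union> snd ` M)\<close> have "0 < WST I"
    using M score_marriage[OF I, of M] by (simp add: is_stable_def)
  with le show ?thesis
    by (simp add: divide_le_eq)
qed

section \<open>An instance attaining the bound\<close>

text \<open>The full relation on \<open>{1, 2}\<close> is the single tie, and \<open>h - 1\<close>
  gives the hospitals lower quotas 0 and 1. With one resident, the hospital lists cannot contain
  ties.\<close>

definition gap_instance :: hrt_mslq where
  "gap_instance = \<lparr>num_res = 1, num_hosp = 2, res_pref = (\<lambda>_. {1, 2} \<times> {1, 2}),
     hosp_pref = (\<lambda>_. {(1, 1)}), lower = (\<lambda>h. h - 1), upper = (\<lambda>_. 1)\<rparr>"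

lemma gap_instance_sets: "residents gap_instance = {1}" "hospitals gap_instance = {1, 2}"
  by (auto simp: gap_instance_def residents_def hospitals_def)

lemma marriage_gap_instance: "marriage_instance gap_instance"
  unfolding marriage_instance_def hrt_mslq_instance_def gap_instance_sets
    total_preorder_on_def preorder_on_def
  by (auto simp: gap_instance_def refl_on_def total_on_def trans_def)

lemma ties_gap_instance: "ties_only_in_residents gap_instance"
  by (simp add: ties_only_in_residents_def gap_instance_def antisym_def)

lemma gap_instance_stable_iff: "is_stable gap_instance M \<longleftrightarrow> M = {(1, 1)} \<or> M = {(1, 2)}"
proof
  assume M: "is_stable gap_instance M"
  then have "M \<subseteq> {1} \<times> {1, 2}"
    unfolding is_stable_def is_matching_def gap_instance_sets by blast
  then have "M \<subseteq> {(1, 1), (1, 2)}"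
    by blast
  then have "M = {} \<or> M = {(1, 1)} \<or> M = {(1, 2)} \<or> M = {(1, 1), (1, 2)}"
    by blast
  \<comment> \<open>This rules out both the empty set and the set with two pairs.\<close>
  moreover have "card (snd ` M) = 1"
    using stable_card_hospitals[OF marriage_gap_instance M] by (simp add: gap_instance_def)
  ultimately show "M = {(1, 1)} \<or> M = {(1, 2)}"
    by auto
next
  assume M: "M = {(1, 1)} \<or> M = {(1, 2)}"
  then have m: "is_matching gap_instance M"
    by (auto simp: is_matching_marriage_iff[OF marriage_gap_instance] gap_instance_sets)
  \<comment> \<open>The resident is matched and, being indifferent, never strictly prefers another
    hospital.\<close>
  have "\<not> blocks gap_instance M r h" for r h
    using M unfolding blocks_marriage_iff[OF marriage_gap_instance m] gap_instance_sets
    by (auto simp: strictly_prefers_def gap_instance_def)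
  with m show "is_stable gap_instance M"
    by (simp add: is_stable_def)
qed

lemma gap_instance_gap: "OPT gap_instance / WST gap_instance = 2"
proof -
  have Z: "{h \<in> hospitals gap_instance. lower gap_instance h = 0} = {1}"
    unfolding gap_instance_sets by (auto simp: gap_instance_def)
  have "score gap_instance M = card (insert 1 (snd ` M))" if "is_stable gap_instance M" for M
    using that score_marriage[OF marriage_gap_instance] by (simp add: Z is_stable_def)
  then have "score gap_instance {(1, 1)} = 1" "score gap_instance {(1, 2)} = 2"
    by (simp_all add: gap_instance_stable_iff)
  moreover have "{score gap_instance M |M. is_stable gap_instance M} =
      {score gap_instance {(1, 1)}, score gap_instance {(1, 2)}}"
    unfolding gap_instance_stable_iff by blast
  ultimately show ?thesis
    by (simp add: OPT_def WST_def)
qed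

theorem proposition31:
  shows "is_maximum {OPT I / WST I |I. marriage_instance I} 2 \<and>
         is_maximum {OPT I / WST I |I. marriage_instance I \<and> ties_only_in_residents I} 2"
proof -
  \<comment> \<open>Attainment in the restricted family passes up to all marriage instances, and the
    bound for all of them passes down.\<close>
  have "2 \<in> {OPT I / WST I |I. marriage_instance I \<and> ties_only_in_residents I}"
    using gap_instance_gap marriage_gap_instance ties_gap_instance
    by (intro CollectI exI[of _ gap_instance]) simp
  then show ?thesis
    unfolding is_maximum_def using marriage_gap_le by blast
qed

end
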